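(* Let $R$ be a Dedekind domain and let $I$ and $J$ be relatively prime (i.e. $I+J=R$) nonzero ideals of $R$ such that $R/I$ and $R/J$ are finite. Then $\mathscr{S}_r(R/IJ)=\mathscr{S}_r(R/I)\,\mathscr{S}_r(R/J)$ for all positive integers $r$.
   Context: For an ideal $I$ of a Dedekind domain $R$ with $R/I$ finite and a positive integer $r$, define $L_r(R/I)=\{a+I\in R/I : a+i+I\in U(R/I)\text{ for all } i\in\{0,1,\ldots,r-1\}\}$, where $U(\cdot)$ denotes the group of units and an integer $i$ is viewed as the element $1+1+\cdots+1$ ($i$ times) of $R$. Set $\mathscr{S}_r(R/I)=|L_r(R/I)|$. *)

theory Defs
  imports "HOL-Algebra.Algebra"
begin

text \<open>
  The field of fractions of a domain R, as a ring record whose elements are the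
  equivalence classes of pairs (a, b), b nonzero, under a/b = c/d iff ad = cb.
\<close>

definition frac_rel :: "('a, 'b) ring_scheme \<Rightarrow> (('a \<times> 'a) \<times> ('a \<times> 'a)) set" where
  "frac_rel R = {((a, b), (c, d)).
      a \<in> carrier R \<and> b \<in> carrier R - {\<zero>\<^bsub>R\<^esub>} \<and> c \<in> carrier R \<and> d \<in> carrier R - {\<zero>\<^bsub>R\<^esub>} \<and>
      a \<otimes>\<^bsub>R\<^esub> d = c \<otimes>\<^bsub>R\<^esub> b}"

definition fraction :: "('a, 'b) ring_scheme \<Rightarrow> 'a \<Rightarrow> 'a \<Rightarrow> ('a \<times> 'a) set" where
  "fraction R a b = frac_rel R `` {(a, b)}"

definition fraction_field :: "('a, 'b) ring_scheme \<Rightarrow> ('a \<times> 'a) set ring" where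
  "fraction_field R =
     \<lparr>carrier = (carrier R \<times> (carrier R - {\<zero>\<^bsub>R\<^esub>})) // frac_rel R,
      monoid.mult = (\<lambda>A B. \<Union>p\<in>A. \<Union>q\<in>B. fraction R (fst p \<otimes>\<^bsub>R\<^esub> fst q) (snd p \<otimes>\<^bsub>R\<^esub> snd q)),
      monoid.one = fraction R \<one>\<^bsub>R\<^esub> \<one>\<^bsub>R\<^esub>,
      ring.zero = fraction R \<zero>\<^bsub>R\<^esub> \<one>\<^bsub>R\<^esub>,
      ring.add = (\<lambda>A B. \<Union>p\<in>A. \<Union>q\<in>B.
               fraction R (fst p \<otimes>\<^bsub>R\<^esub> snd q \<oplus>\<^bsub>R\<^esub> fst q \<otimes>\<^bsub>R\<^esub> snd p) (snd p \<otimes>\<^bsub>R\<^esub> snd q))\<rparr>"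

definition embed_frac :: "('a, 'b) ring_scheme \<Rightarrow> 'a \<Rightarrow> ('a \<times> 'a) set" where
  "embed_frac R a = fraction R a \<one>\<^bsub>R\<^esub>"

context domain
begin

lemma frac_rel_equiv: "equiv (carrier R \<times> (carrier R - {\<zero>})) (frac_rel R)"
proof (rule equivI)
  show "frac_rel R \<subseteq> (carrier R \<times> (carrier R - {\<zero>})) \<times> (carrier R \<times> (carrier R - {\<zero>}))"
    by (auto simp: frac_rel_def)
  show "refl_on (carrier R \<times> (carrier R - {\<zero>})) (frac_rel R)"
    by (auto simp: refl_on_def frac_rel_def)
  show "sym (frac_rel R)"
    by (auto simp: sym_def frac_rel_def)
  show "trans (frac_rel R)"
  proof (rule transI)
    fix x y z
    assume "(x, y) \<in> frac_rel R" "(y, z) \<in> frac_rel R"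
    moreover obtain a b c d e f where "x = (a, b)" "y = (c, d)" "z = (e, f)"
      by (metis surj_pair)
    ultimately have cl: "a \<in> carrier R" "b \<in> carrier R" "c \<in> carrier R"
        "d \<in> carrier R" "e \<in> carrier R" "f \<in> carrier R" "b \<noteq> \<zero>" "d \<noteq> \<zero>" "f \<noteq> \<zero>"
      and eq: "a \<otimes> d = c \<otimes> b" "c \<otimes> f = e \<otimes> d" and xz: "x = (a, b)" "z = (e, f)"
      by (auto simp: frac_rel_def)
    have "d \<otimes> (a \<otimes> f) = (a \<otimes> d) \<otimes> f" using cl by (simp add: m_ac)
    also have "\<dots> = (c \<otimes> f) \<otimes> b" using cl eq by (simp add: m_ac)
    also have "\<dots> = d \<otimes> (e \<otimes> b)" using cl eq by (simp add: m_ac)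
    finally have "a \<otimes> f = e \<otimes> b" using cl m_lcancel by simp
    then show "(x, z) \<in> frac_rel R" using cl xz by (simp add: frac_rel_def)
  qed
qed

lemma fraction_eq_iff:
  assumes "a \<in> carrier R" "b \<in> carrier R - {\<zero>}" "c \<in> carrier R" "d \<in> carrier R - {\<zero>}"
  shows "fraction R a b = fraction R c d \<longleftrightarrow> a \<otimes> d = c \<otimes> b"
  unfolding fraction_def
  using assms eq_equiv_class_iff[OF frac_rel_equiv, of "(a, b)" "(c, d)"]
  by (auto simp: frac_rel_def)

lemma fraction_field_mult:
  assumes "a \<in> carrier R" "b \<in> carrier R - {\<zero>}" "c \<in> carrier R" "d \<in> carrier R - {\<zero>}"
  shows "fraction R a b \<otimes>\<^bsub>fraction_field R\<^esub> fraction R c d = fraction R (a \<otimes> c) (b \<otimes> d)"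
proof -
  have "(\<Union>q\<in>fraction R c d. fraction R (fst p \<otimes> fst q) (snd p \<otimes> snd q))
          = fraction R (a \<otimes> c) (b \<otimes> d)" if p: "p \<in> fraction R a b" for p
  proof -
    have "fraction R (fst p \<otimes> fst q) (snd p \<otimes> snd q) = fraction R (a \<otimes> c) (b \<otimes> d)"
      if q: "q \<in> fraction R c d" for q
    proof -
      obtain a' b' c' d' where pq: "p = (a', b')" "q = (c', d')" by (metis surj_pair)
      have cl: "a' \<in> carrier R" "b' \<in> carrier R" "c' \<in> carrier R" "d' \<in> carrier R"
          "b' \<noteq> \<zero>" "d' \<noteq> \<zero>"
        and eq: "a \<otimes> b' = a' \<otimes> b" "c \<otimes> d' = c' \<otimes> d"
        using p q pq by (auto simp: fraction_def frac_rel_def)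
      have "(a' \<otimes> c') \<otimes> (b \<otimes> d) = (a' \<otimes> b) \<otimes> (c' \<otimes> d)"
        using cl assms by (simp add: m_ac)
      also have "\<dots> = (a \<otimes> b') \<otimes> (c \<otimes> d')" using eq by simp
      also have "\<dots> = (a \<otimes> c) \<otimes> (b' \<otimes> d')"
        using cl assms by (simp add: m_ac)
      finally show ?thesis
        using cl assms pq by (simp add: fraction_eq_iff integral_iff)
    qed
    moreover have "fraction R c d \<noteq> {}"
      using assms by (auto simp: fraction_def frac_rel_def)
    ultimately show ?thesis
      by (simp add: UN_constant_eq)
  qed
  moreover have "fraction R a b \<noteq> {}"
    using assms by (auto simp: fraction_def frac_rel_def)
  ultimately show ?thesis
    unfolding fraction_field_def by (simp add: UN_constant_eq)
qed

lemma fraction_field_add: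
  assumes "a \<in> carrier R" "b \<in> carrier R - {\<zero>}" "c \<in> carrier R" "d \<in> carrier R - {\<zero>}"
  shows "fraction R a b \<oplus>\<^bsub>fraction_field R\<^esub> fraction R c d = fraction R (a \<otimes> d \<oplus> c \<otimes> b) (b \<otimes> d)"
proof -
  have "(\<Union>q\<in>fraction R c d. fraction R (fst p \<otimes> snd q \<oplus> fst q \<otimes> snd p) (snd p \<otimes> snd q))
          = fraction R (a \<otimes> d \<oplus> c \<otimes> b) (b \<otimes> d)" if p: "p \<in> fraction R a b" for p
  proof -
    have "fraction R (fst p \<otimes> snd q \<oplus> fst q \<otimes> snd p) (snd p \<otimes> snd q)
            = fraction R (a \<otimes> d \<oplus> c \<otimes> b) (b \<otimes> d)"
      if q: "q \<in> fraction R c d" for q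
    proof -
      obtain a' b' c' d' where pq: "p = (a', b')" "q = (c', d')" by (metis surj_pair)
      have cl: "a' \<in> carrier R" "b' \<in> carrier R" "c' \<in> carrier R" "d' \<in> carrier R"
          "b' \<noteq> \<zero>" "d' \<noteq> \<zero>"
        and eq: "a \<otimes> b' = a' \<otimes> b" "c \<otimes> d' = c' \<otimes> d"
        using p q pq by (auto simp: fraction_def frac_rel_def)
      have "(a' \<otimes> d' \<oplus> c' \<otimes> b') \<otimes> (b \<otimes> d)
              = (a' \<otimes> b) \<otimes> (d' \<otimes> d) \<oplus> (c' \<otimes> d) \<otimes> (b' \<otimes> b)"
        using cl assms by (simp add: l_distr r_distr m_ac)
      also have "\<dots> = (a \<otimes> b') \<otimes> (d' \<otimes> d) \<oplus> (c \<otimes> d') \<otimes> (b' \<otimes> b)" using eq by simp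
      also have "\<dots> = (a \<otimes> d \<oplus> c \<otimes> b) \<otimes> (b' \<otimes> d')"
        using cl assms by (simp add: l_distr r_distr m_ac)
      finally show ?thesis
        using cl assms pq by (simp add: fraction_eq_iff integral_iff)
    qed
    moreover have "fraction R c d \<noteq> {}"
      using assms by (auto simp: fraction_def frac_rel_def)
    ultimately show ?thesis
      by (simp add: UN_constant_eq)
  qed
  moreover have "fraction R a b \<noteq> {}"
    using assms by (auto simp: fraction_def frac_rel_def)
  ultimately show ?thesis
    unfolding fraction_field_def by (simp add: UN_constant_eq)
qed

lemma fraction_in_carrier:
  "a \<in> carrier R \<Longrightarrow> b \<in> carrier R - {\<zero>} \<Longrightarrow> fraction R a b \<in> carrier (fraction_field R)"
  by (auto simp: fraction_field_def fraction_def intro: quotientI)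

lemma fraction_cases:
  assumes "x \<in> carrier (fraction_field R)"
  obtains a b where "a \<in> carrier R" "b \<in> carrier R" "b \<noteq> \<zero>" "x = fraction R a b"
  using assms by (auto simp: fraction_field_def fraction_def elim!: quotientE)

lemma fraction_field_consts:
  "\<one>\<^bsub>fraction_field R\<^esub> = fraction R \<one> \<one>" "\<zero>\<^bsub>fraction_field R\<^esub> = fraction R \<zero> \<one>"
  by (simp_all add: fraction_field_def)

lemmas fraction_field_simps =
  fraction_in_carrier fraction_eq_iff fraction_field_mult fraction_field_add
  fraction_field_consts integral_iff

lemma fraction_field_is_cring: "cring (fraction_field R)"
proof (rule cringI)
  show "abelian_group (fraction_field R)"
  proof (rule abelian_groupI)
    fix x assume "x \<in> carrier (fraction_field R)"
    then obtain a b where ab: "a \<in> carrier R" "b \<in> carrier R" "b \<noteq> \<zero>" "x = fraction R a b"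
      by (rule fraction_cases)
    show "\<exists>y\<in>carrier (fraction_field R). y \<oplus>\<^bsub>fraction_field R\<^esub> x = \<zero>\<^bsub>fraction_field R\<^esub>"
      by (rule bexI[of _ "fraction R (\<ominus> a) b"])
         (use ab in \<open>simp_all add: fraction_field_simps l_minus l_neg\<close>)
  qed (auto elim!: fraction_cases simp: fraction_field_simps l_distr r_distr m_ac a_ac)
  show "comm_monoid (fraction_field R)"
    by (rule comm_monoidI) (auto elim!: fraction_cases simp: fraction_field_simps m_ac)
  fix x y z
  assume xyz: "x \<in> carrier (fraction_field R)" "y \<in> carrier (fraction_field R)"
    "z \<in> carrier (fraction_field R)"
  obtain a b where "a \<in> carrier R" "b \<in> carrier R" "b \<noteq> \<zero>" "x = fraction R a b"
    using xyz(1) by (rule fraction_cases)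
  moreover obtain c d where "c \<in> carrier R" "d \<in> carrier R" "d \<noteq> \<zero>" "y = fraction R c d"
    using xyz(2) by (rule fraction_cases)
  moreover obtain e f where "e \<in> carrier R" "f \<in> carrier R" "f \<noteq> \<zero>" "z = fraction R e f"
    using xyz(3) by (rule fraction_cases)
  ultimately show "(x \<oplus>\<^bsub>fraction_field R\<^esub> y) \<otimes>\<^bsub>fraction_field R\<^esub> z =
      x \<otimes>\<^bsub>fraction_field R\<^esub> z \<oplus>\<^bsub>fraction_field R\<^esub> y \<otimes>\<^bsub>fraction_field R\<^esub> z"
    by (simp add: fraction_field_simps l_distr r_distr m_ac)
qed

lemma fraction_field_is_field: "field (fraction_field R)"
proof (rule cring.cring_fieldI2[OF fraction_field_is_cring])
  show "\<zero>\<^bsub>fraction_field R\<^esub> \<noteq> \<one>\<^bsub>fraction_field R\<^esub>"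
    by (simp add: fraction_field_simps)
  fix x assume "x \<in> carrier (fraction_field R)" and nz: "x \<noteq> \<zero>\<^bsub>fraction_field R\<^esub>"
  then obtain a b where ab: "a \<in> carrier R" "b \<in> carrier R" "b \<noteq> \<zero>" "x = fraction R a b"
    by (blast elim: fraction_cases)
  then have "a \<noteq> \<zero>" using nz by (auto simp: fraction_field_simps)
  then show "\<exists>y\<in>carrier (fraction_field R). x \<otimes>\<^bsub>fraction_field R\<^esub> y = \<one>\<^bsub>fraction_field R\<^esub>"
    by (intro bexI[of _ "fraction R b a"]) (use ab in \<open>simp_all add: fraction_field_simps m_ac\<close>)
qed

lemma embed_frac_hom: "embed_frac R \<in> ring_hom R (fraction_field R)"
  by (rule ring_hom_memI) (simp_all add: embed_frac_def fraction_field_simps)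

lemma embed_frac_inj: "inj_on (embed_frac R) (carrier R)"
  by (rule inj_onI) (simp add: embed_frac_def fraction_field_simps)

lemma fraction_mult_embed:
  assumes "a \<in> carrier R" "b \<in> carrier R - {\<zero>}"
  shows "fraction R a b \<otimes>\<^bsub>fraction_field R\<^esub> embed_frac R b = embed_frac R a"
  using assms by (simp add: embed_frac_def fraction_field_simps m_ac)

end

text \<open>
  Polynomials are coefficient lists with the leading coefficient first; the zero
  polynomial is the empty list, on which \<^const>\<open>hd\<close> is unspecified, so it is excluded.
\<close>

definition integral_over :: "('a, 'b) ring_scheme \<Rightarrow> 'a set \<Rightarrow> 'a \<Rightarrow> bool" where
  "integral_over K S x \<longleftrightarrow>
     (\<exists>p \<in> carrier (univ_poly K S). p \<noteq> [] \<and> lead_coeff p = \<one>\<^bsub>K\<^esub> \<and> ring.eval K p x = \<zero>\<^bsub>K\<^esub>)"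

text \<open>
  Krull dimension at most 1, so fields are included.
\<close>

locale dedekind_domain = noetherian_domain +
  assumes integrally_closed:
    "\<lbrakk>x \<in> carrier (fraction_field R);
      integral_over (fraction_field R) (embed_frac R ` carrier R) x\<rbrakk>
     \<Longrightarrow> x \<in> embed_frac R ` carrier R"
    and primeideal_maximal: "\<lbrakk>primeideal P R; P \<noteq> {\<zero>}\<rbrakk> \<Longrightarrow> maximalideal P R"

definition L_set :: "nat \<Rightarrow> ('a, 'b) ring_scheme \<Rightarrow> 'a set \<Rightarrow> 'a set set" where
  "L_set r R I = {I +>\<^bsub>R\<^esub> a | a. a \<in> carrier R \<and>
     (\<forall>i\<in>{0..<r}. I +>\<^bsub>R\<^esub> (a \<oplus>\<^bsub>R\<^esub> ([i] \<cdot>\<^bsub>R\<^esub> \<one>\<^bsub>R\<^esub>)) \<in> Units (R Quot I))}"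

definition schemmel :: "nat \<Rightarrow> ('a, 'b) ring_scheme \<Rightarrow> 'a set \<Rightarrow> nat" where
  "schemmel r R I = card (L_set r R I)"

end

theory Submission
  imports Defs
begin

text \<open>
  For comaximal ideals \<open>I\<close> and \<open>J\<close> we have \<open>I \<cdot> J = I \<inter> J\<close>, and by the Chinese remainder theorem
  intersecting cosets is a bijection from pairs of a coset of \<open>I\<close> and a coset of \<open>J\<close> to the cosets
  of \<open>I \<inter> J\<close>. An element is a unit modulo \<open>I \<inter> J\<close> iff it is a unit modulo \<open>I\<close> and modulo \<open>J\<close>, and
  the bijection respects translation by integers, so it carries \<open>L\<^sub>r(R/I) \<times> L\<^sub>r(R/J)\<close> to
  \<open>L\<^sub>r(R/IJ)\<close>.
\<close>

lemma (in ideal) mem_a_rcos_iff: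
  assumes "a \<in> carrier R"
  shows "x \<in> I +> a \<longleftrightarrow> x \<in> carrier R \<and> x \<ominus> a \<in> I"
proof -
  interpret abelian_subgroup I R
    using abelian_subgroupI3[OF additive_subgroup_axioms is_abelian_group] .
  have "I +> a \<subseteq> carrier R"
    using assms a_subset by (rule_tac a_r_coset_subset_G)
  then show ?thesis
    using a_rcos_module_minus[OF ring_axioms assms] by blast
qed

context ring
begin

lemma a_rcos_inter:
  assumes "ideal I R" "ideal J R" "a \<in> carrier R"
  shows "(I \<inter> J) +> a = (I +> a) \<inter> (J +> a)"
  using assms by (auto simp: ideal.mem_a_rcos_iff i_intersect)

lemma a_rcos_inter_eq_iff:
  assumes "ideal I R" "ideal J R" "a \<in> carrier R" "b \<in> carrier R"
  shows "(I \<inter> J) +> a = (I \<inter> J) +> b \<longleftrightarrow> I +> a = I +> b \<and> J +> a = J +> b"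
  using assms by (auto simp: quotient_eq_iff_same_a_r_cos[symmetric] i_intersect)

text \<open>This is surjectivity of \<open>canonical_proj I J\<close>, the map sending
  \<open>x\<close> to \<open>(I +> x, J +> x)\<close>, unpacked into a common
  representative.\<close>

lemma comaximal_solve_congruences:
  assumes "ideal I R" "ideal J R" "I <+> J = carrier R" "a \<in> carrier R" "b \<in> carrier R"
  obtains c where "c \<in> carrier R" "I +> c = I +> a" "J +> c = J +> b"
proof -
  have "(I +> a, J +> b) \<in> carrier (RDirProd (R Quot I) (R Quot J))"
    using assms by (auto simp: RDirProd_carrier FactRing_simps)
  then have "(I +> a, J +> b) \<in> canonical_proj I J ` carrier R"
    by (simp only: canonical_proj_is_surj[OF assms(1-3)])
  then show thesis
    using that by auto
qed

end

context cring
begin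

text \<open>Every coset has a representative and the quotient is commutative, so invertibility
  becomes a congruence in \<open>R\<close>, where inverses for two ideals can be glued.\<close>

lemma Units_Quot_iff:
  assumes "ideal I R" "a \<in> carrier R"
  shows "I +> a \<in> Units (R Quot I) \<longleftrightarrow> (\<exists>b\<in>carrier R. I +> a \<otimes> b = I +> \<one>)"
  using assms
  by (auto simp: Units_def FactRing_simps ideal.rcoset_mult_add m_comm)

text \<open>An inverse modulo the intersection serves for both ideals. Conversely, an element
  congruent to the one inverse modulo \<open>I\<close> and to the other modulo \<open>J\<close> is
  an inverse modulo both.\<close>

lemma Units_Quot_inter_iff:
  assumes "ideal I R" "ideal J R" "I <+> J = carrier R" and a: "a \<in> carrier R"
  shows "(I \<inter> J) +> a \<in> Units (R Quot (I \<inter> J)) \<longleftrightarrow>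
    I +> a \<in> Units (R Quot I) \<and> J +> a \<in> Units (R Quot J)"
proof -
  have "\<exists>c\<in>carrier R. I +> a \<otimes> c = I +> \<one> \<and> J +> a \<otimes> c = J +> \<one>"
    if b: "b \<in> carrier R" "b' \<in> carrier R" "I +> a \<otimes> b = I +> \<one>" "J +> a \<otimes> b' = J +> \<one>" for b b'
  proof -
    obtain c where c: "c \<in> carrier R" "I +> c = I +> b" "J +> c = J +> b'"
      using comaximal_solve_congruences[OF assms(1-3) b(1,2)] .
    have "I +> a \<otimes> c = I +> a \<otimes> b" "J +> a \<otimes> c = J +> a \<otimes> b'"
      using assms(1,2)[THEN ideal.rcoset_mult_add, OF a, symmetric] b(1,2) c by simp_all
    then show ?thesis
      using b c(1) by auto
  qed
  then show ?thesis
    using assms by (auto simp: Units_Quot_iff i_intersect a_rcos_inter_eq_iff)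
qed

lemma schemmel_mult:
  assumes I: "ideal I R" and J: "ideal J R" and comax: "I <+> J = carrier R"
  shows "schemmel r R (I \<cdot> J) = schemmel r R I * schemmel r R J"
proof -
  define P where "P K a \<longleftrightarrow> (\<forall>i\<in>{0..<r}. K +> (a \<oplus> [i] \<cdot> \<one>) \<in> Units (R Quot K))" for K a
  have L: "L_set r R K = (+>) K ` {a \<in> carrier R. P K a}" for K
    by (auto simp: L_set_def P_def)
  have P_inter: "P (I \<inter> J) a \<longleftrightarrow> P I a \<and> P J a" if "a \<in> carrier R" for a
    using that Units_Quot_inter_iff[OF assms] by (auto simp: P_def)
  \<comment> \<open>\<open>P\<close> is a condition on representatives; it must not depend on the
    choice, since the common representative \<open>c\<close> below replaces \<open>a\<close> and
    \<open>b\<close>.\<close>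
  have P_cong: "P K a \<longleftrightarrow> P K b"
    if "ideal K R" "a \<in> carrier R" "b \<in> carrier R" "K +> a = K +> b" for K a b
    using that ideal.a_rcos_sum[OF that(1), symmetric] by (simp add: P_def)
  let ?A = "{a \<in> carrier R. P (I \<inter> J) a}"
  have "L_set r R I \<times> L_set r R J \<subseteq> canonical_proj I J ` ?A"
  proof clarify
    fix U V assume "U \<in> L_set r R I" "V \<in> L_set r R J"
    then obtain a b where ab: "a \<in> carrier R" "P I a" "U = I +> a" "b \<in> carrier R" "P J b" "V = J +> b"
      by (auto simp: L)
    obtain c where c: "c \<in> carrier R" "I +> c = I +> a" "J +> c = J +> b"
      using comaximal_solve_congruences[OF assms ab(1,4)] .
    have "P (I \<inter> J) c"
      using P_cong[OF I c(1) ab(1) c(2)] P_cong[OF J c(1) ab(4) c(3)] ab P_inter c(1) by simp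
    then show "(U, V) \<in> canonical_proj I J ` ?A"
      using ab c by auto
  qed
  moreover have "canonical_proj I J ` ?A \<subseteq> L_set r R I \<times> L_set r R J"
    by (auto simp: L P_inter)
  ultimately have prod: "L_set r R I \<times> L_set r R J = canonical_proj I J ` ?A"
    by blast
  \<comment> \<open>Each pair in this domain has the form \<open>(I +> c, J +> c)\<close>, so its
    intersection is the coset of \<open>c\<close> modulo \<open>I \<inter> J\<close>, which in turn
    determines both components.\<close>
  have "bij_betw (\<lambda>(U, V). U \<inter> V) (canonical_proj I J ` ?A) (L_set r R (I \<inter> J))"
    unfolding bij_betw_def
    by (auto simp: inj_on_def L image_image a_rcos_inter[OF I J, symmetric]
        a_rcos_inter_eq_iff[OF I J])
  then have "card (L_set r R (I \<inter> J)) = card (L_set r R I \<times> L_set r R J)"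
    by (simp add: prod bij_betw_same_card)
  then show ?thesis
    by (simp add: schemmel_def ideal_prod_eq_inter[OF assms] card_cartesian_product)
qed

end

theorem theorem2p1:
  fixes R :: "('a, 'b) ring_scheme" (structure) and I J :: "'a set" and r :: nat
  assumes "dedekind_domain R"
    and "ideal I R" and "ideal J R"
    and "I \<noteq> {\<zero>}" and "J \<noteq> {\<zero>}"
    and "I <+> J = carrier R"
    and "finite (carrier (R Quot I))" and "finite (carrier (R Quot J))"
    and "r > 0"
  shows "schemmel r R (I \<cdot> J) = schemmel r R I * schemmel r R J"
proof -
  interpret dedekind_domain R by fact
  show ?thesis
    using assms(2,3,6) by (rule schemmel_mult)
qed

end
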